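(* Let $n,c$ be positive integers, let $r,h$ be integers and let $l\ge 0$ be an integer. Put $$S(q)=\sum_{\substack{k\in\mathbb{Z}\\ k\equiv r\pmod{c}}}(-1)^kq^{\binom{k}{2}+hk}\begin{bmatrix} n\\ k\end{bmatrix}_{q}\begin{bmatrix} (k-r)/c\\ l\end{bmatrix}_{q^{c}}$$ (only finitely many terms are nonzero) and $$P(q)=\prod_{\substack{d\ge 1\\ c\mid d}}\Phi_d(q)^{\lfloor n/d\rfloor-\lfloor lc/d\rfloor}\cdot\prod_{\substack{b\mid c\\ b<c}}\Phi_b(q)^{\lfloor n/b\rfloor-\lfloor r/b\rfloor-\lfloor (n-r)/b\rfloor},$$ where $\Phi_d$ is the $d$-th cyclotomic polynomial (the first product is finite, since its exponents vanish for $d>\max(n,lc)$; exponents may be negative). Then $S(q)$ is divisible by $P(q)$, i.e. $S(q)/P(q)\in\mathbb{Z}[q,q^{-1}]$.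
   Context: For an integer $m$, $[m]_q=\frac{1-q^m}{1-q}$. For an integer $m$ (possibly negative) and an integer $k$, the $q$-binomial coefficient is $\begin{bmatrix} m\\ k\end{bmatrix}_q=\frac{[m]_q[m-1]_q\cdots[m-k+1]_q}{[k]_q[k-1]_q\cdots[1]_q}$ for $k>0$, $\begin{bmatrix} m\\ 0\end{bmatrix}_q=1$, and $\begin{bmatrix} m\\ k\end{bmatrix}_q=0$ for $k<0$; $\begin{bmatrix} m\\ k\end{bmatrix}_{q^c}$ means the same with $q$ replaced by $q^c$. $\lfloor x\rfloor$ is the floor function. *)

theory Defs
  imports
    Complex_Main
    "HOL-Library.Groups_Big_Fun"
    "HOL-Computational_Algebra.Computational_Algebra"
    "HOL-Number_Theory.Cong"
begin

text \<open>
  The base \<open>q\<close> is an explicit parameter, so that the change of base \<open>q \<mapsto> q ^ c\<close> is a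
  substitution. The indeterminate itself is \<open>qvar\<close> below.
\<close>

definition q_bracket :: "'a::field \<Rightarrow> int \<Rightarrow> 'a" where
  "q_bracket q m = (1 - q powi m) / (1 - q)"

definition q_binomial :: "'a::field \<Rightarrow> int \<Rightarrow> int \<Rightarrow> 'a" where
  "q_binomial q m k =
     (if k < 0 then 0
      else (\<Prod>i<nat k. q_bracket q (m - int i)) / (\<Prod>i<nat k. q_bracket q (k - int i)))"

definition cyclotomic_poly :: "nat \<Rightarrow> complex poly" where
  "cyclotomic_poly d =
     (\<Prod>\<omega>\<in>{\<omega>. \<omega> ^ d = 1 \<and> (\<forall>j. 0 < j \<and> j < d \<longrightarrow> \<omega> ^ j \<noteq> 1)}. [:- \<omega>, 1:])"

text \<open>
  All computations take place in the field of rational functions over the complex numbers, where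
  the cyclotomic polynomials are given by their linear factors. The ring of Laurent polynomials in
  \<open>qvar\<close> with integer coefficients is a subset of it.
\<close>

abbreviation qvar :: "complex poly fract" where
  "qvar \<equiv> to_fract [:0, 1:]"


definition int_laurent_polys :: "complex poly fract set" where
  "int_laurent_polys = {to_fract (map_poly of_int p) * qvar powi j | (p :: int poly) (j :: int). True}"

text \<open>
  \<open>Sum_any\<close> and \<open>Prod_any\<close> are the sum and product over all arguments,
  meaningful when all but finitely many terms are \<open>0\<close> respectively \<open>1\<close>; this is the case here by
  the lemmas that follow. On integers \<open>div\<close> rounds towards minus infinity, so \<open>x div int d\<close> is the
  floor of \<open>x / d\<close> also for negative \<open>x\<close>; the quotient \<open>(k - r) div int c\<close> is exact whenever it occurs
  in \<open>S_sum\<close>.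
\<close>

definition S_term :: "nat \<Rightarrow> nat \<Rightarrow> int \<Rightarrow> int \<Rightarrow> nat \<Rightarrow> int \<Rightarrow> complex poly fract" where
  "S_term n c r h l k =
     (-1) powi k * qvar powi (k * (k - 1) div 2 + h * k)
       * q_binomial qvar (int n) k * q_binomial (qvar ^ c) ((k - r) div int c) (int l)"

definition S_sum :: "nat \<Rightarrow> nat \<Rightarrow> int \<Rightarrow> int \<Rightarrow> nat \<Rightarrow> complex poly fract" where
  "S_sum n c r h l = Sum_any (\<lambda>k. if [k = r] (mod int c) then S_term n c r h l k else 0)"

definition P_prod :: "nat \<Rightarrow> nat \<Rightarrow> int \<Rightarrow> nat \<Rightarrow> complex poly fract" where
  "P_prod n c r l =
     Prod_any (\<lambda>d. if d \<ge> 1 \<and> c dvd d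
       then to_fract (cyclotomic_poly d) powi (int n div int d - int (l * c) div int d) else 1)
     * (\<Prod>b\<in>{b. b dvd c \<and> b < c}.
          to_fract (cyclotomic_poly b) powi (int n div int b - r div int b - (int n - r) div int b))"

lemma q_binomial_eq_0:
  assumes "n < k"
  shows "q_binomial q (int n) (int k) = 0"
proof -
  have "(\<Prod>i<k. q_bracket q (int n - int i)) = 0"
    using assms by (intro prod_zero) (auto simp: q_bracket_def intro!: bexI[of _ n])
  then show ?thesis by (simp add: q_binomial_def)
qed

lemma finite_support_S_sum:
  "finite {k. (if [k = r] (mod int c) then S_term n c r h l k else 0) \<noteq> 0}"
proof (rule finite_subset)
  show "{k. (if [k = r] (mod int c) then S_term n c r h l k else 0) \<noteq> 0} \<subseteq> {0..int n}"
  proof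
    fix k assume "k \<in> {k. (if [k = r] (mod int c) then S_term n c r h l k else 0) \<noteq> 0}"
    then have nz: "q_binomial qvar (int n) k \<noteq> 0"
      by (auto simp: S_term_def split: if_splits)
    then have "k \<ge> 0" by (auto simp: q_binomial_def split: if_splits)
    moreover have "k \<le> int n"
      using nz q_binomial_eq_0[of n "nat k" qvar] \<open>k \<ge> 0\<close>
      by (metis int_nat_eq linorder_not_le zless_nat_conj nat_int nat_less_iff)
    ultimately show "k \<in> {0..int n}" by simp
  qed
qed simp

lemma finite_support_P_prod:
  "finite {d. (if d \<ge> 1 \<and> c dvd d
       then to_fract (cyclotomic_poly d) powi (int n div int d - int (l * c) div int d) else 1) \<noteq> 1}"
proof (rule finite_subset)
  show "{d. (if d \<ge> 1 \<and> c dvd d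
       then to_fract (cyclotomic_poly d) powi (int n div int d - int (l * c) div int d) else 1) \<noteq> 1}
     \<subseteq> {..max n (l * c)}"
  proof
    fix d
    assume d: "d \<in> {d. (if d \<ge> 1 \<and> c dvd d
       then to_fract (cyclotomic_poly d) powi (int n div int d - int (l * c) div int d) else 1) \<noteq> 1}"
    show "d \<in> {..max n (l * c)}"
    proof (rule ccontr)
      assume "d \<notin> {..max n (l * c)}"
      then have "int n div int d = 0" "int (l * c) div int d = 0"
        by (auto simp flip: zdiv_int simp del: of_nat_mult)
      then show False using d by (auto simp del: of_nat_mult split: if_splits)
    qed
  qed
qed simp

lemma P_prod_nonzero: "P_prod n c r l \<noteq> 0"
proof -
  have prod_nz: "prod f A \<noteq> 0" if "\<And>x. x \<in> A \<Longrightarrow> f x \<noteq> 0"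
    for f :: "'b \<Rightarrow> 'a::idom" and A
    using that by (cases "finite A") auto
  have "cyclotomic_poly d \<noteq> 0" for d
    unfolding cyclotomic_poly_def by (intro prod_nz) auto
  then show ?thesis
    unfolding P_prod_def Prod_any.expand_set by (intro no_zero_divisors prod_nz) auto
qed

end

theory Submission
  imports Defs
begin

text \<open>
  Since \<open>S\<close> is an integral Laurent polynomial and the cyclotomic polynomials are monic with integer
  coefficients, it suffices to bound from below the order of vanishing of \<open>S\<close> at each primitive
  \<open>d\<close>-th root of unity \<open>\<omega>\<close> by the exponent of the \<open>d\<close>-th cyclotomic polynomial in \<open>P\<close>.

  If \<open>c\<close> divides \<open>d\<close>, multiply \<open>S\<close> by the product of \<open>1 - q ^ (c * j)\<close> over \<open>1 \<le> j \<le> l\<close>, which has order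
  \<open>l * c div d\<close> at \<open>\<omega>\<close>. The second \<open>q\<close>-binomial then becomes a polynomial in \<open>q powi k\<close>, so only sums of
  \<open>(-1) ^ k * q ^ (k choose 2) * q powi (h' * k)\<close> times \<open>n\<close> choose \<open>k\<close> over \<open>k \<equiv> r\<close> modulo \<open>c\<close> remain, for
  varying \<open>h'\<close>. Filtering with \<open>\<xi> = \<omega> ^ (d div c)\<close> and the \<open>q\<close>-binomial theorem turn each of them into a
  combination of the products of \<open>1 - \<xi> ^ t * q powi (h' + j)\<close> over \<open>j < n\<close>, in which at least
  \<open>n div d\<close> factors vanish at \<open>\<omega>\<close>.

  If \<open>d\<close> is a proper divisor of \<open>c\<close>, the \<open>q\<close>-binomial \<open>n\<close> choose \<open>k\<close> already vanishes to order
  \<open>n div d - k div d - (n - k) div d\<close>, which depends only on \<open>k\<close> modulo \<open>d\<close>.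
\<close>

subsection \<open>Laurent polynomials and vanishing order\<close>

text \<open>A common frame for integrality and vanishing: \<open>int_laurent_polys\<close> and
  \<open>vanishing\<close> both have this form, so closure properties are derived once from those of
  \<open>R\<close>.\<close>

definition laurent :: "complex poly set \<Rightarrow> complex poly fract set" where
  "laurent R = {to_fract p * qvar powi j | p j. p \<in> R}"

text \<open>For \<omega> \<noteq> 0 the powers of \<open>qvar\<close> are units at \<omega>, so this
  means a zero of order at least \<open>e\<close> there; \<open>e = 0\<close> gives all complex
  Laurent polynomials.\<close>

definition vanishing :: "complex \<Rightarrow> nat \<Rightarrow> complex poly fract set" where
  "vanishing \<omega> e = laurent {p. [:- \<omega>, 1:] ^ e dvd p}"

lemma qvar_nonzero [simp]: "qvar \<noteq> 0"
  by simp

lemma to_fract_power: "to_fract (p ^ n) = to_fract p ^ n"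
  by (induction n) auto

lemma to_fract_prod: "to_fract (prod f A) = (\<Prod>x\<in>A. to_fract (f x))"
  by (induction A rule: infinite_finite_induct) auto

lemma qvar_powi_shift:
  assumes "m \<le> i"
  shows "qvar powi i = to_fract ([:0, 1:] ^ nat (i - m)) * qvar powi m"
proof -
  have "qvar powi i = qvar powi (i - m) * qvar powi m"
    by (subst power_int_add[symmetric]) auto
  then show ?thesis using assms by (simp add: to_fract_power power_int_nonneg_exp)
qed

lemma laurentI: "p \<in> R \<Longrightarrow> to_fract p * qvar powi j \<in> laurent R"
  by (auto simp: laurent_def)

lemma laurentE:
  assumes "f \<in> laurent R"
  obtains p j where "p \<in> R" "f = to_fract p * qvar powi j"
  using assms by (auto simp: laurent_def)

lemma laurent_to_fract: "p \<in> R \<Longrightarrow> to_fract p \<in> laurent R"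
  using laurentI[of p R 0] by simp

lemma laurent_uminus:
  assumes "f \<in> laurent R" and "\<And>p. p \<in> R \<Longrightarrow> - p \<in> R"
  shows "- f \<in> laurent R"
  using assms by (metis laurentE laurentI mult_minus_left to_fract_uminus)

lemma laurent_mult:
  assumes "f \<in> laurent R" and "g \<in> laurent R'"
    and "\<And>p p'. p \<in> R \<Longrightarrow> p' \<in> R' \<Longrightarrow> p * p' \<in> R''"
  shows "f * g \<in> laurent R''"
proof -
  from assms(1,2) obtain p j p' j' where *: "p \<in> R" "f = to_fract p * qvar powi j"
    "p' \<in> R'" "g = to_fract p' * qvar powi j'"
    by (metis laurentE)
  then have "f * g = to_fract (p * p') * qvar powi (j + j')"
    by (simp add: power_int_add)
  with * assms(3) show ?thesis by (metis laurentI)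
qed

lemma laurent_add:
  assumes "f \<in> laurent R" and "g \<in> laurent R"
    and add: "\<And>p p'. p \<in> R \<Longrightarrow> p' \<in> R \<Longrightarrow> p + p' \<in> R"
    and shift: "\<And>p. p \<in> R \<Longrightarrow> p * [:0, 1:] \<in> R"
  shows "f + g \<in> laurent R"
proof -
  from assms(1,2) obtain p j p' j' where *: "p \<in> R" "f = to_fract p * qvar powi j"
    "p' \<in> R" "g = to_fract p' * qvar powi j'"
    by (metis laurentE)
  \<comment> \<open>Factoring out the smaller power of \<open>qvar\<close> leaves genuine
    polynomials to be added.\<close>
  define m where "m = min j j'"
  have shift_power: "p * [:0, 1:] ^ n \<in> R" if "p \<in> R" for p n
    using that by (induction n arbitrary: p) (auto simp: mult.assoc[symmetric] intro: shift simp del: mult_pCons_right mult_pCons_left)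
  have "f + g = to_fract (p * [:0, 1:] ^ nat (j - m) + p' * [:0, 1:] ^ nat (j' - m)) * qvar powi m"
    using qvar_powi_shift[of m j] qvar_powi_shift[of m j'] * by (simp add: m_def ring_distribs mult.assoc)
  then show ?thesis using * by (metis laurentI add shift_power)
qed

section \<open>The ring of integral Laurent polynomials\<close>

lemma int_laurent_polys_eq: "int_laurent_polys = laurent (range (map_poly of_int))"
  by (auto simp: int_laurent_polys_def laurent_def)

lemma map_poly_of_int_add:
  "map_poly of_int (p + q) = (map_poly of_int p + map_poly of_int q :: 'a::comm_ring_1 poly)"
  by (intro poly_eqI) (simp add: coeff_map_poly)

lemma map_poly_of_int_uminus:
  "map_poly of_int (- p) = (- map_poly of_int p :: 'a::comm_ring_1 poly)"
  by (intro poly_eqI) (simp add: coeff_map_poly)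

lemma map_poly_of_int_mult:
  "map_poly of_int (p * q) = (map_poly of_int p * map_poly of_int q :: 'a::comm_ring_1 poly)"
  by (intro poly_eqI) (simp add: coeff_map_poly coeff_mult)

lemma map_poly_of_int_1 [simp]: "map_poly of_int 1 = (1 :: 'a::comm_ring_1 poly)"
  by (intro poly_eqI) (simp add: coeff_map_poly)

lemma map_poly_of_int_eq_0_iff [simp]:
  "map_poly of_int p = (0 :: 'a::{comm_ring_1, ring_char_0} poly) \<longleftrightarrow> p = 0"
  by (auto simp: poly_eq_iff coeff_map_poly)

lemma map_poly_of_int_prod:
  "map_poly of_int (prod f A) = (\<Prod>x\<in>A. map_poly of_int (f x) :: 'a::comm_ring_1 poly)"
  by (induction A rule: infinite_finite_induct) (auto simp: map_poly_of_int_mult)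

lemma map_poly_of_int_power:
  "map_poly of_int (p ^ n) = (map_poly of_int p ^ n :: 'a::comm_ring_1 poly)"
  by (induction n) (auto simp: map_poly_of_int_mult)

lemma map_poly_of_int_X [simp]: "map_poly of_int [:0, 1:] = ([:0, 1:] :: 'a::comm_ring_1 poly)"
  by (simp add: map_poly_pCons)

lemma int_laurent_add:
  assumes "f \<in> int_laurent_polys" "g \<in> int_laurent_polys"
  shows "f + g \<in> int_laurent_polys"
  using assms unfolding int_laurent_polys_eq
proof (rule laurent_add)
  fix p p' :: "complex poly"
  assume "p \<in> range (map_poly of_int)" "p' \<in> range (map_poly of_int)"
  then show "p + p' \<in> range (map_poly of_int)"
    by (auto simp flip: map_poly_of_int_add)
next
  fix p :: "complex poly"
  assume "p \<in> range (map_poly of_int)"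
  then show "p * [:0, 1:] \<in> range (map_poly of_int)"
    by (metis (no_types) imageE map_poly_of_int_X map_poly_of_int_mult rangeI)
qed

lemma int_laurent_mult:
  assumes "f \<in> int_laurent_polys" "g \<in> int_laurent_polys"
  shows "f * g \<in> int_laurent_polys"
  using assms unfolding int_laurent_polys_eq
  by (rule laurent_mult) (auto simp flip: map_poly_of_int_mult)

lemma int_laurent_uminus: "f \<in> int_laurent_polys \<Longrightarrow> - f \<in> int_laurent_polys"
  unfolding int_laurent_polys_eq
  by (erule laurent_uminus) (auto simp flip: map_poly_of_int_uminus)

lemma int_laurent_diff:
  "f \<in> int_laurent_polys \<Longrightarrow> g \<in> int_laurent_polys \<Longrightarrow> f - g \<in> int_laurent_polys"
  using int_laurent_add[of f "- g"] int_laurent_uminus[of g] by simp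

lemma int_laurent_powi [simp]: "qvar powi j \<in> int_laurent_polys"
  unfolding int_laurent_polys_eq using laurentI[of 1 "range (map_poly of_int)" j]
  by (metis map_poly_of_int_1 mult_1 rangeI to_fract_1)

lemma int_laurent_1 [simp]: "1 \<in> int_laurent_polys"
  using int_laurent_powi[of 0] by simp

lemma int_laurent_0 [simp]: "0 \<in> int_laurent_polys"
  using int_laurent_diff[of 1 1] by simp

lemma int_laurent_minus_one_powi [simp]: "(-1) powi k \<in> int_laurent_polys"
  by (cases "even k") (auto intro: int_laurent_uminus)

lemma int_laurent_sum:
  "(\<And>x. x \<in> A \<Longrightarrow> f x \<in> int_laurent_polys) \<Longrightarrow> sum f A \<in> int_laurent_polys"
  by (induction A rule: infinite_finite_induct) (auto intro: int_laurent_add)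

section \<open>Arithmetic of vanishing orders\<close>

lemma vanishing_add:
  "f \<in> vanishing \<omega> e \<Longrightarrow> g \<in> vanishing \<omega> e \<Longrightarrow> f + g \<in> vanishing \<omega> e"
  unfolding vanishing_def by (erule (1) laurent_add) (auto simp del: mult_pCons_right mult_pCons_left intro: dvd_mult2)

lemma vanishing_uminus: "f \<in> vanishing \<omega> e \<Longrightarrow> - f \<in> vanishing \<omega> e"
  unfolding vanishing_def by (erule laurent_uminus) auto

lemma vanishing_diff:
  "f \<in> vanishing \<omega> e \<Longrightarrow> g \<in> vanishing \<omega> e \<Longrightarrow> f - g \<in> vanishing \<omega> e"
  using vanishing_add[of f \<omega> e "- g"] vanishing_uminus[of g] by simp

lemma vanishing_mult:
  "f \<in> vanishing \<omega> e \<Longrightarrow> g \<in> vanishing \<omega> e' \<Longrightarrow> f * g \<in> vanishing \<omega> (e + e')"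
  unfolding vanishing_def by (erule (1) laurent_mult) (auto simp: power_add mult_dvd_mono)

lemma vanishing_mult_right:
  "f \<in> vanishing \<omega> e \<Longrightarrow> g \<in> vanishing \<omega> 0 \<Longrightarrow> f * g \<in> vanishing \<omega> e"
  using vanishing_mult[of f \<omega> e g 0] by simp

lemma vanishing_mult_left:
  "f \<in> vanishing \<omega> 0 \<Longrightarrow> g \<in> vanishing \<omega> e \<Longrightarrow> f * g \<in> vanishing \<omega> e"
  using vanishing_mult[of f \<omega> 0 g e] by simp

lemma vanishing_antimono: "e \<le> e' \<Longrightarrow> vanishing \<omega> e' \<subseteq> vanishing \<omega> e"
  unfolding vanishing_def laurent_def using power_le_dvd by blast

lemma vanishing_to_fract: "to_fract p \<in> vanishing \<omega> 0"
  unfolding vanishing_def by (rule laurent_to_fract) simp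

lemma vanishing_powi: "qvar powi j \<in> vanishing \<omega> 0"
  using laurentI[of 1 UNIV j] by (simp add: vanishing_def)

lemma vanishing_1: "1 \<in> vanishing \<omega> 0"
  using vanishing_powi[of 0] by simp

lemma vanishing_0: "0 \<in> vanishing \<omega> e"
  unfolding vanishing_def using laurent_to_fract[of 0] by fastforce

lemma vanishing_sum: "(\<And>x. x \<in> A \<Longrightarrow> f x \<in> vanishing \<omega> e) \<Longrightarrow> sum f A \<in> vanishing \<omega> e"
  by (induction A rule: infinite_finite_induct) (auto intro: vanishing_add vanishing_0)

lemma vanishing_prod: "(\<And>x. x \<in> A \<Longrightarrow> f x \<in> vanishing \<omega> 0) \<Longrightarrow> prod f A \<in> vanishing \<omega> 0"
  by (induction A rule: infinite_finite_induct) (auto intro: vanishing_mult_left vanishing_1)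

lemma int_laurent_vanishing: "int_laurent_polys \<subseteq> vanishing \<omega> 0"
  by (auto simp: int_laurent_polys_eq vanishing_def laurent_def)

text \<open>Orders at \<omega> add in a product, so cancelling \<open>u\<close> costs only the order
  of \<open>u\<close>.\<close>

lemma linear_power_dvd_cancel:
  fixes u p :: "'a::idom poly"
  assumes "[:- \<omega>, 1:] ^ e dvd u * p" and "u \<noteq> 0"
  shows "[:- \<omega>, 1:] ^ (e - order \<omega> u) dvd p"
proof (cases "p = 0")
  case False
  with assms have "e \<le> order \<omega> (u * p)"
    by (metis mult_eq_0_iff order_divides)
  also have "\<dots> = order \<omega> u + order \<omega> p"
    using False assms by (intro order_mult) auto
  finally have "e - order \<omega> u \<le> order \<omega> p" by simp
  then show ?thesis by (simp add: order_divides)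
qed simp

text \<open>The polynomial part of a Laurent polynomial is determined only up to powers of the
  indeterminate. These have order 0 at \<omega> \<noteq> 0, so the divisibility passes to any chosen
  representative.\<close>

lemma vanishing_dvd:
  assumes "to_fract p * qvar powi i \<in> vanishing \<omega> e" and "\<omega> \<noteq> 0"
  shows "[:- \<omega>, 1:] ^ e dvd p"
proof -
  from assms(1) obtain p' j where p': "[:- \<omega>, 1:] ^ e dvd p'"
    "to_fract p * qvar powi i = to_fract p' * qvar powi j"
    unfolding vanishing_def laurent_def by auto
  define m where "m = min i j"
  have "to_fract (p * [:0, 1:] ^ nat (i - m)) * qvar powi m
      = to_fract (p' * [:0, 1:] ^ nat (j - m)) * qvar powi m"
    using p'(2) qvar_powi_shift[of m i] qvar_powi_shift[of m j] by (simp add: m_def mult.assoc)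
  then have "to_fract (p * [:0, 1:] ^ nat (i - m)) = to_fract (p' * [:0, 1:] ^ nat (j - m))"
    by (metis mult_right_cancel power_int_eq_0_iff qvar_nonzero)
  then have "p * [:0, 1:] ^ nat (i - m) = p' * [:0, 1:] ^ nat (j - m)"
    by (simp only: to_fract_eq_iff)
  then have "[:- \<omega>, 1:] ^ e dvd [:0, 1:] ^ nat (i - m) * p"
    using p'(1) by (metis dvd_mult2 mult.commute)
  from linear_power_dvd_cancel[OF this] show ?thesis
    using assms(2) by (simp add: order_0I)
qed

subsection \<open>Gaussian binomial coefficients\<close>

text \<open>The q-Pochhammer symbol (q; q)_n, over rings so that it also makes sense for
  polynomials, where orders of zeros are available.\<close>

definition qfact :: "'a::comm_ring_1 \<Rightarrow> nat \<Rightarrow> 'a" where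
  "qfact q n = (\<Prod>j<n. 1 - q ^ Suc j)"

text \<open>The numerator of the Gaussian binomial with the powers of 1 - q cleared; over fields,
  since the exponents may be negative.\<close>

definition qfalling :: "'a::field \<Rightarrow> int \<Rightarrow> nat \<Rightarrow> 'a" where
  "qfalling q m k = (\<Prod>i<k. 1 - q powi (m - int i))"

lemma qfact_0 [simp]: "qfact q 0 = 1"
  by (simp add: qfact_def)

lemma qfact_Suc: "qfact q (Suc n) = qfact q n * (1 - q ^ Suc n)"
  by (simp add: qfact_def)

lemma qfalling_0 [simp]: "qfalling q m 0 = 1"
  by (simp add: qfalling_def)

lemma qfalling_Suc: "qfalling q m (Suc k) = qfalling q m k * (1 - q powi (m - int k))"
  by (simp add: qfalling_def)

lemma qfalling_Suc': "qfalling q m (Suc k) = (1 - q powi m) * qfalling q (m - 1) k"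
  by (simp add: qfalling_def prod.lessThan_Suc_shift algebra_simps del: prod.lessThan_Suc)

lemma qfalling_mult_qfact:
  assumes "k \<le> n"
  shows "qfalling q (int n) k * qfact q (n - k) = qfact q n"
  using assms
proof (induction k)
  case (Suc k)
  then have "n - k = Suc (n - Suc k)" by simp
  moreover have "q powi (int n - int k) = q ^ (n - k)"
    using Suc.prems by (metis Suc_leD of_nat_diff power_int_of_nat)
  ultimately have "qfalling q (int n) (Suc k) * qfact q (n - Suc k) = qfalling q (int n) k * qfact q (n - k)"
    by (simp add: qfalling_Suc qfact_Suc mult_ac)
  then show ?case using Suc by simp
qed simp

lemma qfact_nonzero: "(\<And>i. i > 0 \<Longrightarrow> q ^ i \<noteq> 1) \<Longrightarrow> qfact (q :: 'a::idom) n \<noteq> 0"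
  by (induction n) (auto simp: qfact_Suc simp del: power_Suc)

text \<open>The powers of 1 - q in numerator and denominator cancel, and
  \<open>qfalling q (int k) k\<close> is \<open>qfact q k\<close>.\<close>

lemma q_binomial_altdef:
  assumes "\<And>i. i > 0 \<Longrightarrow> q ^ i \<noteq> 1"
  shows "q_binomial q m (int k) = qfalling q m k / qfact q k"
proof -
  have "1 - q \<noteq> 0" using assms[of 1] by simp
  moreover have "(\<Prod>i<k. q_bracket q (m - int i)) = qfalling q m k / (1 - q) ^ k" for m
    by (simp add: q_bracket_def qfalling_def prod_dividef)
  ultimately show ?thesis
    using qfalling_mult_qfact[of k k q] by (simp add: q_binomial_def)
qed

lemma q_binomial_0: "q_binomial q m 0 = 1"
  by (simp add: q_binomial_def)

lemma q_binomial_0_left: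
  "q_binomial q 0 (int (Suc k)) = 0"
  using q_binomial_eq_0[of 0 "Suc k" q] by simp

lemma q_binomial_pascal:
  assumes q: "\<And>i. i > 0 \<Longrightarrow> q ^ i \<noteq> 1" and "q \<noteq> 0"
  shows "q_binomial (q :: 'a :: field) (m + 1) (int (Suc k))
    = q_binomial q m (int k) + q ^ Suc k * q_binomial q m (int (Suc k))"
proof -
  have nz: "1 - q ^ Suc k \<noteq> 0" "qfact q k \<noteq> 0"
    using q[of "Suc k"] qfact_nonzero[of q k] q by (auto simp del: power_Suc)
  have "q ^ Suc k * q powi (m - int k) = q powi (int (Suc k) + (m - int k))"
    using \<open>q \<noteq> 0\<close> by (subst power_int_add) (auto simp: power_int_of_nat simp del: of_nat_Suc power_Suc)
  then have shift: "q powi (m + 1) = q ^ Suc k * q powi (m - int k)"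
    by (simp add: add.commute)
  have "q_binomial q (m + 1) (int (Suc k)) = (1 - q powi (m + 1)) * qfalling q m k / (qfact q k * (1 - q ^ Suc k))"
    using q by (subst q_binomial_altdef) (auto simp: qfalling_Suc' qfact_Suc)
  moreover have "q_binomial q m (int (Suc k)) = qfalling q m k * (1 - q powi (m - int k)) / (qfact q k * (1 - q ^ Suc k))"
    using q by (subst q_binomial_altdef) (auto simp: qfalling_Suc qfact_Suc)
  moreover have "q_binomial q m (int k) = qfalling q m k / qfact q k"
    using q by (rule q_binomial_altdef)
  \<comment> \<open>With Q = \<open>q ^ Suc k\<close> and u = \<open>q powi (m - int k)\<close> the
    rule reduces to 1 - Q u = (1 - Q) + Q (1 - u).\<close>
  moreover have "(1 - Q * u) * N / (F * (1 - Q)) = N / F + Q * (N * (1 - u) / (F * (1 - Q)))"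
    if "1 - Q \<noteq> 0" "F \<noteq> 0" for Q u N F :: 'a
    using that by (simp add: divide_simps) (simp add: algebra_simps)
  ultimately show ?thesis using nz by (simp only: shift)
qed

lemma q_binomial_mult_qfact:
  assumes "\<And>i. i > 0 \<Longrightarrow> q ^ i \<noteq> 1" and "k \<le> n"
  shows "q_binomial q (int n) (int k) * qfact q k * qfact q (n - k) = qfact q n"
  using qfact_nonzero[of q k] qfalling_mult_qfact[OF assms(2), of q] assms(1)
  by (simp add: q_binomial_altdef)

text \<open>Induction on \<open>n\<close> for all \<open>z\<close>: splitting off the factor
  \<open>j = 0\<close> replaces \<open>z\<close> by \<open>z * q\<close> in the remaining product,
  and the coefficients then match by Pascal's rule.\<close>

lemma q_binomial_theorem:
  assumes q: "\<And>i. i > 0 \<Longrightarrow> q ^ i \<noteq> 1" and "q \<noteq> (0 :: 'a :: field)"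
  shows "(\<Prod>j<n. 1 - z * q ^ j)
    = (\<Sum>k\<le>n. (-1) ^ k * q ^ (k choose 2) * q_binomial q (int n) (int k) * z ^ k)"
proof (induction n arbitrary: z)
  case 0
  then show ?case by (simp add: q_binomial_0 binomial_eq_0)
next
  case (Suc n)
  define a where "a n k = (-1) ^ k * q ^ (k choose 2) * q_binomial q (int n) (int k)" for n k
  \<comment> \<open>The factor \<open>q ^ k\<close> arises from (k + 1 choose 2) = (k choose 2) +
    k.\<close>
  have a_Suc: "a (Suc n) (Suc k) = a n (Suc k) * q ^ Suc k - a n k * q ^ k" for k
    using q_binomial_pascal[OF q \<open>q \<noteq> 0\<close>, of "int n" k]
    by (simp add: a_def numeral_2_eq_2 power_add algebra_simps)
  have a_0: "a m 0 = 1" for m by (simp add: a_def q_binomial_0 binomial_eq_0)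
  have a_big: "a n (Suc n) = 0" using q_binomial_eq_0[of n "Suc n" q] by (simp add: a_def)
  have "(\<Prod>j<Suc n. 1 - z * q ^ j) = (1 - z) * (\<Prod>j<n. 1 - (z * q) * q ^ j)"
    by (simp add: prod.lessThan_Suc_shift mult_ac del: prod.lessThan_Suc)
  also have "\<dots> = (1 - z) * (\<Sum>k\<le>n. a n k * (z * q) ^ k)"
    by (simp add: Suc.IH a_def)
  also have "\<dots> = (\<Sum>k\<le>Suc n. a n k * (z * q) ^ k) - (\<Sum>k\<le>n. a n k * q ^ k * z ^ Suc k)"
    by (simp add: a_big algebra_simps sum_distrib_left sum_subtractf power_mult_distrib)
  also have "\<dots> = 1 + (\<Sum>k\<le>n. (a n (Suc k) * q ^ Suc k - a n k * q ^ k) * z ^ Suc k)"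
    by (subst sum.atMost_Suc_shift) (simp add: a_0 algebra_simps sum_subtractf power_mult_distrib)
  also have "\<dots> = (\<Sum>k\<le>Suc n. a (Suc n) k * z ^ k)"
    by (subst sum.atMost_Suc_shift) (simp add: a_0 a_Suc)
  finally show ?case by (simp add: a_def)
qed

section \<open>Integrality of Gaussian binomials in the indeterminate\<close>

lemma qvar_power_neq_1: "i > 0 \<Longrightarrow> qvar ^ i \<noteq> 1"
proof
  assume "i > 0" "qvar ^ i = 1"
  then have "to_fract ([:0, 1:] ^ i) = to_fract (1 :: complex poly)" by (simp add: to_fract_power)
  then have "[:0, 1:] ^ i = (1 :: complex poly)" by (simp only: to_fract_eq_iff)
  then have "poly ([:0, 1:] ^ i) 0 = (1 :: complex)" by simp
  then show False using \<open>i > 0\<close> by (simp add: poly_power zero_power)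
qed

lemma qvar_power_power_neq_1: "c > 0 \<Longrightarrow> i > 0 \<Longrightarrow> (qvar ^ c) ^ i \<noteq> 1"
  using qvar_power_neq_1[of "c * i"] by (simp add: power_mult)

text \<open>The recursion in \<open>q_binomial_pascal\<close> is run in both directions to reach negative \<open>m\<close>.\<close>

lemma int_laurent_q_binomial_nat:
  assumes "c > 0"
  shows "q_binomial (qvar ^ c) m (int k) \<in> int_laurent_polys"
proof (induction k arbitrary: m)
  case 0
  then show ?case by (simp add: q_binomial_0)
next
  case (Suc k)
  have pow: "(qvar ^ c) ^ i \<in> int_laurent_polys" "inverse ((qvar ^ c) ^ i) \<in> int_laurent_polys" for i
    using int_laurent_powi[of "int (c * i)"] int_laurent_powi[of "- int (c * i)"]
    by (simp_all only: power_int_minus power_int_of_nat power_mult)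
  show ?case
  proof (induction m rule: int_induct[where k = 0])
    case base
    then show ?case using q_binomial_0_left[of "qvar ^ c" k] by simp
  next
    case (step1 i)
    then show ?case
      using Suc pow(1)[of "Suc k"] q_binomial_pascal[OF qvar_power_power_neq_1[OF assms], of i k]
      by (auto intro!: int_laurent_add int_laurent_mult simp del: power_Suc of_nat_Suc)
  next
    case (step2 i)
    \<comment> \<open>Pascal's rule solved for the entry at \<open>i - 1\<close>; the division is by
      a power of \<open>qvar\<close>, a unit among Laurent polynomials.\<close>
    have "q_binomial (qvar ^ c) (i - 1) (int (Suc k)) = inverse ((qvar ^ c) ^ Suc k) *
        (q_binomial (qvar ^ c) i (int (Suc k)) - q_binomial (qvar ^ c) (i - 1) (int k))"
      using q_binomial_pascal[OF qvar_power_power_neq_1[OF assms], of "i - 1" k]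
      by (simp del: power_Suc of_nat_Suc)
    then show ?case
      using Suc step2 pow(2)[of "Suc k"]
      by (auto intro!: int_laurent_diff int_laurent_mult simp del: power_Suc of_nat_Suc)
  qed
qed

lemma int_laurent_q_binomial:
  assumes "c > 0"
  shows "q_binomial (qvar ^ c) m k \<in> int_laurent_polys"
  using int_laurent_q_binomial_nat[OF assms, of m "nat k"]
  by (cases "k < 0") (auto simp: q_binomial_def)

lemma int_laurent_S_sum:
  assumes "c > 0"
  shows "S_sum n c r h l \<in> int_laurent_polys"
  unfolding S_sum_def Sum_any.expand_set S_term_def
  using int_laurent_q_binomial[of 1] int_laurent_q_binomial[OF assms]
  by (intro int_laurent_sum) (auto intro!: int_laurent_mult)

subsection \<open>Cyclotomic polynomials\<close>

text \<open>For \<open>d = 0\<close> the condition is vacuous and every complex number qualifies, so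
  the facts about orders of roots assume \<open>d > 0\<close>.\<close>

definition primitive_roots :: "nat \<Rightarrow> complex set" where
  "primitive_roots d = {\<omega>. \<omega> ^ d = 1 \<and> (\<forall>j. 0 < j \<and> j < d \<longrightarrow> \<omega> ^ j \<noteq> 1)}"

lemma cyclotomic_poly_altdef: "cyclotomic_poly d = (\<Prod>\<omega>\<in>primitive_roots d. [:- \<omega>, 1:])"
  by (simp add: cyclotomic_poly_def primitive_roots_def)

lemma finite_primitive_roots: "d > 0 \<Longrightarrow> finite (primitive_roots d)"
  by (rule finite_subset[OF _ finite_roots_unity[of d]]) (auto simp: primitive_roots_def)

lemma primitive_root_power_eq_1_iff:
  assumes "\<omega> \<in> primitive_roots d" "d > 0"
  shows "\<omega> ^ j = 1 \<longleftrightarrow> d dvd j"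
proof -
  have "\<omega> ^ j = \<omega> ^ (d * (j div d) + j mod d)" by simp
  also have "\<dots> = \<omega> ^ (j mod d)"
    using assms(1) by (simp only: power_add power_mult) (simp add: primitive_roots_def)
  finally have "\<omega> ^ j = \<omega> ^ (j mod d)" .
  moreover have "j mod d < d" using assms by simp
  ultimately show ?thesis
    using assms(1) by (cases "j mod d = 0") (auto simp: primitive_roots_def dvd_eq_mod_eq_0)
qed

lemma primitive_root_nonzero: "\<omega> \<in> primitive_roots d \<Longrightarrow> d > 0 \<Longrightarrow> \<omega> \<noteq> 0"
  by (auto simp: primitive_roots_def zero_power)

lemma primitive_root_powi_eq_1:
  assumes "\<omega> \<in> primitive_roots d" "d > 0" "int d dvd j"
  shows "\<omega> powi j = 1"
proof -
  obtain i where "j = int d * i" using assms(3) by auto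
  then show ?thesis using assms(1) by (simp add: power_int_mult primitive_roots_def)
qed

lemma primitive_roots_disjoint:
  assumes "d > 0" "d' > 0" "d \<noteq> d'"
  shows "primitive_roots d \<inter> primitive_roots d' = {}"
proof -
  have "d = d'" if "\<omega> \<in> primitive_roots d" "\<omega> \<in> primitive_roots d'" for \<omega>
    using that assms primitive_root_power_eq_1_iff by (metis dvd_antisym dvd_refl)
  with assms show ?thesis by auto
qed

text \<open>Every root of unity is primitive for its least positive annihilating exponent, and that
  exponent divides \<open>d\<close>.\<close>

lemma roots_of_unity_eq_Union:
  assumes "d > 0"
  shows "{\<omega>. \<omega> ^ d = 1} = (\<Union>e\<in>{e. e dvd d}. primitive_roots e)"
proof (intro equalityI subsetI)
  fix \<omega> :: complex assume "\<omega> \<in> {\<omega>. \<omega> ^ d = 1}"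
  then have ex: "\<exists>e. e > 0 \<and> \<omega> ^ e = 1" using assms by auto
  define e where "e = (LEAST e. e > 0 \<and> \<omega> ^ e = 1)"
  have "e > 0" "\<omega> ^ e = 1" using LeastI_ex[OF ex] by (auto simp: e_def)
  moreover have "\<omega> ^ j \<noteq> 1" if "0 < j" "j < e" for j
    using not_less_Least[of j "\<lambda>e. e > 0 \<and> \<omega> ^ e = 1"] that by (auto simp: e_def)
  ultimately have "\<omega> \<in> primitive_roots e" "e > 0" by (auto simp: primitive_roots_def)
  moreover from this have "e dvd d"
    using \<open>\<omega> \<in> {\<omega>. \<omega> ^ d = 1}\<close> primitive_root_power_eq_1_iff by blast
  ultimately show "\<omega> \<in> (\<Union>e\<in>{e. e dvd d}. primitive_roots e)" by auto
next
  fix \<omega> :: complex assume "\<omega> \<in> (\<Union>e\<in>{e. e dvd d}. primitive_roots e)"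
  then show "\<omega> \<in> {\<omega>. \<omega> ^ d = 1}" by (auto simp: primitive_roots_def power_mult elim!: dvdE)
qed

text \<open>Linear factors at distinct points are coprime: the product over \<open>A\<close> has
  order 0 at a new point, so the new power must divide the cofactor.\<close>

lemma prod_linear_powers_dvd:
  fixes p :: "'a::idom poly"
  assumes "finite A" and "\<And>\<omega>. \<omega> \<in> A \<Longrightarrow> [:- \<omega>, 1:] ^ m \<omega> dvd p"
  shows "(\<Prod>\<omega>\<in>A. [:- \<omega>, 1:] ^ m \<omega>) dvd p"
  using assms
proof (induction A rule: finite_induct)
  case (insert \<omega> A)
  define Q where "Q = (\<Prod>\<omega>\<in>A. [:- \<omega>, 1:] ^ m \<omega>)"
  have "Q dvd p" unfolding Q_def using insert by blast
  then obtain r where r: "p = Q * r" by (rule dvdE)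
  have "poly Q \<omega> \<noteq> 0"
    using insert.hyps by (auto simp: Q_def poly_prod poly_power)
  then have ord: "order \<omega> Q = 0" and "Q \<noteq> 0" by (auto intro: order_0I)
  have "[:- \<omega>, 1:] ^ m \<omega> dvd Q * r"
    using insert.prems r by blast
  from linear_power_dvd_cancel[OF this \<open>Q \<noteq> 0\<close>] have "[:- \<omega>, 1:] ^ m \<omega> dvd r"
    unfolding ord by simp
  then have "[:- \<omega>, 1:] ^ m \<omega> * Q dvd r * Q"
    by (rule mult_dvd_mono) (rule dvd_refl)
  then show ?case unfolding r Q_def prod.insert[OF insert.hyps] by (subst (2) mult.commute)
qed simp

section \<open>Orders of q-factorials at roots of unity\<close>

lemma one_minus_X_power_nonzero: "j > 0 \<Longrightarrow> 1 - [:0, 1:] ^ j \<noteq> (0 :: complex poly)"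
proof
  assume "j > 0" "1 - [:0, 1:] ^ j = (0 :: complex poly)"
  then have "poly (1 - [:0, 1:] ^ j) 0 = (0 :: complex)" by simp
  then show False using \<open>j > 0\<close> by (simp add: poly_power zero_power)
qed

text \<open>All zeros are simple, because the derivative, a nonzero multiple of a power of X, does
  not vanish at \<omega> \<noteq> 0.\<close>

lemma order_one_minus_X_power:
  assumes "\<omega> \<in> primitive_roots d" "d > 0" "j > 0"
  shows "order \<omega> (1 - [:0, 1:] ^ j) = (if d dvd j then 1 else 0)"
proof (cases "d dvd j")
  case True
  let ?p = "1 - [:0, 1:] ^ j :: complex poly"
  have "\<omega> ^ j = 1" using True primitive_root_power_eq_1_iff[OF assms(1,2)] by simp
  then have root: "poly ?p \<omega> = 0" by (simp add: poly_power)
  have nz: "?p \<noteq> 0" using assms(3) by (rule one_minus_X_power_nonzero)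
  have "poly (pderiv ?p) \<omega> \<noteq> 0"
    using assms(3) primitive_root_nonzero[OF assms(1,2)]
    by (cases j) (auto simp: pderiv_diff pderiv_power_Suc pderiv_pCons poly_power simp del: of_nat_Suc power_Suc)
  then show ?thesis
    using order_pderiv[OF nz root] True by (simp add: order_0I)
next
  case False
  then have "poly (1 - [:0, 1:] ^ j) \<omega> \<noteq> 0"
    using primitive_root_power_eq_1_iff[OF assms(1,2), of j] by (simp add: poly_power)
  with False show ?thesis by (simp add: order_0I)
qed

lemma qfact_X_power_nonzero: "c > 0 \<Longrightarrow> qfact ([:0, 1:] ^ c :: complex poly) l \<noteq> 0"
  unfolding qfact_def using one_minus_X_power_nonzero[of "c * Suc j" for j]
  by (auto simp flip: power_mult simp del: mult_Suc_right power_Suc)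

text \<open>The factor with exponent \<open>c * j\<close> has a simple zero exactly when
  \<open>d dvd c * j\<close>. Writing \<open>d = c * m\<close>, this says \<open>m dvd j\<close>,
  and \<open>l div m\<close> of the indices up to \<open>l\<close> satisfy it.\<close>

lemma order_qfact:
  assumes "\<omega> \<in> primitive_roots d" "d > 0" "c > 0" "c dvd d"
  shows "order \<omega> (qfact ([:0, 1:] ^ c) l) = l * c div d"
proof (induction l)
  case 0
  then show ?case by (simp add: order_0I)
next
  case (Suc l)
  obtain m where m: "d = c * m" "m > 0" using assms by (auto elim: dvdE)
  have "([:0, 1:] ^ c) ^ Suc l = ([:0, 1:] :: complex poly) ^ (c * Suc l)"
    by (simp only: power_mult)
  moreover have "order \<omega> (qfact ([:0, 1:] ^ c) (Suc l))
     = order \<omega> (qfact ([:0, 1:] ^ c) l) + order \<omega> (1 - ([:0, 1:] ^ c) ^ Suc l)"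
    unfolding qfact_Suc
    by (rule order_mult) (metis assms(3) qfact_X_power_nonzero qfact_Suc)
  ultimately have "order \<omega> (qfact ([:0, 1:] ^ c) (Suc l)) = l * c div d + (if d dvd c * Suc l then 1 else 0)"
    using Suc order_one_minus_X_power[OF assms(1,2), of "c * Suc l"] assms(3) by simp
  also have "\<dots> = l div m + (if m dvd Suc l then 1 else 0)"
    using assms(3) m by (simp add: mult.commute[of l] del: mult_Suc_right)
  also have "\<dots> = Suc l div m" by (simp add: div_Suc dvd_eq_mod_eq_0)
  also have "\<dots> = Suc l * c div d" using assms(3) m by (simp add: mult.commute[of _ c] del: mult_Suc mult_Suc_right)
  finally show ?case .
qed

lemma to_fract_qfact: "to_fract (qfact p l) = qfact (to_fract p) l"
  by (simp add: qfact_def to_fract_prod to_fract_power del: power_Suc)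

lemma to_fract_qfact_X: "to_fract (qfact ([:0, 1:] ^ c) l) = qfact (qvar ^ c) l"
  by (simp add: to_fract_qfact to_fract_power)

text \<open>Knowing beforehand that \<open>f\<close> is a Laurent polynomial supplies a numerator,
  from which the q-factorial is cancelled at the cost of its order.\<close>

lemma vanishing_cancel_qfact:
  assumes "f \<in> vanishing \<omega> 0" "f * qfact (qvar ^ c) l \<in> vanishing \<omega> e"
    and "\<omega> \<in> primitive_roots d" "d > 0" "c > 0" "c dvd d"
  shows "f \<in> vanishing \<omega> (e - l * c div d)"
proof -
  obtain p j where f: "f = to_fract p * qvar powi j"
    using assms(1) by (auto simp: vanishing_def laurent_def)
  have "to_fract (qfact ([:0, 1:] ^ c) l * p) * qvar powi j \<in> vanishing \<omega> e"
    using assms(2) by (simp add: f to_fract_qfact_X mult_ac)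
  then have "[:- \<omega>, 1:] ^ e dvd qfact ([:0, 1:] ^ c) l * p"
    using primitive_root_nonzero[OF assms(3,4)] by (rule vanishing_dvd)
  then have "[:- \<omega>, 1:] ^ (e - l * c div d) dvd p"
    using linear_power_dvd_cancel qfact_X_power_nonzero[OF assms(5)] order_qfact[OF assms(3-6)] by metis
  then show ?thesis unfolding f vanishing_def by (intro laurentI) simp
qed

section \<open>Integrality of cyclotomic polynomials\<close>

lemma prod_roots_of_unity:
  assumes "d > 0"
  shows "(\<Prod>\<omega>\<in>{\<omega> :: complex. \<omega> ^ d = 1}. [:- \<omega>, 1:]) = [:0, 1:] ^ d - 1"
    (is "?l = ?r")
\<comment> \<open>Two polynomials of degree at most \<open>d\<close> with equal coefficients at
  \<open>d\<close> that agree at \<open>d\<close> points coincide.\<close>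
proof (rule poly_eqI_degree_lead_coeff[where n = d and A = "{\<omega>. \<omega> ^ d = 1}"])
  have fin: "finite {\<omega> :: complex. \<omega> ^ d = 1}" using assms by (intro finite_roots_unity) simp
  have deg: "degree ?l = d"
    using card_roots_unity_eq[OF assms] by (subst degree_prod_eq_sum_degree) auto
  then show "degree ?l \<le> d" by simp
  have r: "?r = monom 1 d - 1" by (simp add: monom_altdef)
  show "degree ?r \<le> d" unfolding r by (intro degree_diff_le) (auto simp: degree_monom_le)
  have "lead_coeff ?l = 1" by (simp add: lead_coeff_prod)
  then show "coeff ?l d = coeff ?r d" unfolding deg r using assms by simp
  show "d \<le> card {\<omega> :: complex. \<omega> ^ d = 1}" using card_roots_unity_eq[OF assms] by simp
  show "poly ?l z = poly ?r z" if "z \<in> {\<omega>. \<omega> ^ d = 1}" for z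
    using that fin by (auto simp: poly_prod poly_power)
qed

text \<open>The linear factors are grouped by the exact order of their roots.\<close>

lemma X_power_minus_1_eq_prod_cyclotomic:
  assumes "d > 0"
  shows "[:0, 1:] ^ d - 1 = (\<Prod>e\<in>{e. e dvd d}. cyclotomic_poly e)"
proof -
  have "(\<Prod>\<omega>\<in>(\<Union>e\<in>{e. e dvd d}. primitive_roots e). [:- \<omega>, 1:])
      = (\<Prod>e\<in>{e. e dvd d}. \<Prod>\<omega>\<in>primitive_roots e. [:- \<omega>, 1:])"
    using assms
    by (intro prod.UNION_disjoint ballI finite_primitive_roots primitive_roots_disjoint impI)
       (auto intro: dvd_pos_nat)
  then show ?thesis
    using assms by (simp add: cyclotomic_poly_altdef prod_roots_of_unity flip: roots_of_unity_eq_Union)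
qed


text \<open>Long division by a monic integer polynomial never leaves the integers: the leading
  coefficient of the quotient is a coefficient of \<open>a\<close>.\<close>

lemma monic_int_poly_quotient:
  fixes b :: "complex poly"
  assumes "lead_coeff p = 1" and "map_poly of_int a = map_poly of_int p * b"
  shows "b \<in> range (map_poly of_int)"
proof -
  let ?P = "map_poly of_int p :: complex poly"
  have P: "lead_coeff ?P = 1" "degree ?P = degree p"
    using assms(1) by (simp_all add: coeff_map_poly degree_map_poly)
  \<comment> \<open>Induction on a strict bound \<open>N\<close> for the degree of the quotient;
    \<open>a\<close> varies as well, since each division step changes the dividend.\<close>
  have "b \<in> range (map_poly of_int)"
    if "map_poly of_int a = ?P * b" "\<And>i. i \<ge> N \<Longrightarrow> coeff b i = 0" for N a b
    using that
  proof (induction N arbitrary: a b)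
    case 0
    then have "b = map_poly of_int 0" by (intro poly_eqI) simp
    then show ?case by blast
  next
    case (Suc N)
    show ?case
    proof (cases "coeff b N = 0")
      case True
      then have "coeff b i = 0" if "i \<ge> N" for i
        using that Suc.prems(2) by (cases "i = N") auto
      then show ?thesis using Suc.IH Suc.prems(1) by blast
    next
      case False
      then have "degree b = N"
        using Suc.prems(2) by (intro antisym degree_le le_degree) (auto simp: Suc_le_eq)
      define z where "z = coeff a (degree p + N)"
      have "of_int z = coeff (?P * b) (degree ?P + degree b)"
        unfolding Suc.prems(1)[symmetric] by (simp add: z_def coeff_map_poly P \<open>degree b = N\<close>)
      also have "\<dots> = coeff b N"
        unfolding coeff_mult_degree_sum P(1) by (simp add: \<open>degree b = N\<close>)
      finally have z: "coeff b N = of_int z" by simp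
      have mono: "map_poly of_int (monom z N) = (monom (of_int z) N :: complex poly)"
        by (simp add: map_poly_monom)
      \<comment> \<open>One step of long division: the top term of the quotient is removed.\<close>
      have "map_poly of_int (a + - (p * monom z N)) = ?P * (b - monom (of_int z) N)"
        unfolding map_poly_of_int_add map_poly_of_int_uminus map_poly_of_int_mult mono Suc.prems(1)
        by (simp add: right_diff_distrib)
      moreover have "coeff (b - monom (of_int z) N) i = 0" if "i \<ge> N" for i
        using that Suc.prems(2) z by (cases "i = N") auto
      ultimately have "b - monom (of_int z) N \<in> range (map_poly of_int)" by (rule Suc.IH)
      then obtain b' where "b - monom (of_int z) N = map_poly of_int b'" by blast
      then have "b = map_poly of_int (b' + monom z N)"
        by (simp add: map_poly_of_int_add mono algebra_simps)
      then show ?thesis by blast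
    qed
  qed
  from this[OF assms(2), of "Suc (degree b)"] show ?thesis
    by (simp add: coeff_eq_0)
qed

text \<open>Strong induction: in the factorisation of X^d - 1 the factors for proper divisors form a
  monic integer polynomial, and exact division by it preserves integrality.\<close>

lemma cyclotomic_poly_int:
  assumes "d > 0"
  shows "\<exists>p :: int poly. lead_coeff p = 1 \<and> cyclotomic_poly d = map_poly of_int p"
  using assms
proof (induction d rule: less_induct)
  case (less d)
  let ?E = "{e. e dvd d} - {d}"
  have "\<exists>p :: int poly. lead_coeff p = 1 \<and> cyclotomic_poly e = map_poly of_int p" if "e \<in> ?E" for e
    using that less by (intro less.IH) (auto simp: dvd_imp_le le_neq_implies_less intro: dvd_pos_nat)
  then obtain C :: "nat \<Rightarrow> int poly"
    where C: "\<And>e. e \<in> ?E \<Longrightarrow> lead_coeff (C e) = 1"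
      "\<And>e. e \<in> ?E \<Longrightarrow> cyclotomic_poly e = map_poly of_int (C e)"
    by metis
  define Q where "Q = (\<Prod>e\<in>?E. C e)"
  have Q: "lead_coeff Q = 1" "map_poly of_int Q = (\<Prod>e\<in>?E. cyclotomic_poly e)"
    using C by (simp_all add: Q_def lead_coeff_prod map_poly_of_int_prod)
  have "[:0, 1:] ^ d - 1 = map_poly of_int Q * cyclotomic_poly d"
    unfolding Q using less.prems
    by (subst X_power_minus_1_eq_prod_cyclotomic, simp)
       (subst prod.remove[of _ d], auto simp: mult.commute)
  moreover have "[:0, 1:] ^ d - 1 = (map_poly of_int ([:0, 1:] ^ d + - 1) :: complex poly)"
    by (simp only: map_poly_of_int_add map_poly_of_int_uminus map_poly_of_int_power map_poly_of_int_1 map_poly_of_int_X) simp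
  ultimately have eq: "map_poly of_int ([:0, 1:] ^ d + - 1) = map_poly of_int Q * cyclotomic_poly d"
    by simp
  from monic_int_poly_quotient[OF Q(1) this] obtain p where p: "cyclotomic_poly d = map_poly of_int p"
    by blast
  have "lead_coeff (cyclotomic_poly d) = 1"
    by (simp add: cyclotomic_poly_altdef lead_coeff_prod)
  then have "lead_coeff p = 1"
    by (simp add: p coeff_map_poly degree_map_poly)
  with p show ?case by blast
qed

subsection \<open>Sums over an arithmetic progression\<close>

lemma vanishing_to_fract_powi: "to_fract p * qvar powi i \<in> vanishing \<omega> 0"
  using vanishing_mult_left[OF vanishing_to_fract vanishing_powi] .

lemma vanishing_one_minus: "1 - to_fract p * qvar powi i \<in> vanishing \<omega> 0"
  by (intro vanishing_diff vanishing_1 vanishing_to_fract_powi)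

text \<open>Multiplying by \<open>qvar ^ m\<close>, with \<open>m\<close> the negative part of
  \<open>i\<close>, gives a polynomial that has \<omega> as a root.\<close>

lemma vanishing_one_minus_root:
  assumes "\<omega> \<noteq> 0" "x * \<omega> powi i = 1"
  shows "1 - to_fract [:x:] * qvar powi i \<in> vanishing \<omega> 1"
proof -
  define m where "m = nat (- i)"
  define k where "k = nat i"
  have i: "i = int k - int m" by (simp add: m_def k_def)
  have "\<omega> ^ m = x * \<omega> ^ k"
    using assms by (simp add: i power_int_diff field_simps)
  define P where "P = [:0, 1:] ^ m - [:x:] * [:0, 1:] ^ k"
  have "[:- \<omega>, 1:] ^ 1 dvd P"
    using \<open>\<omega> ^ m = x * \<omega> ^ k\<close> by (simp add: P_def poly_power flip: poly_eq_0_iff_dvd)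
  moreover have "1 - to_fract [:x:] * qvar powi i
      = to_fract P * qvar powi (- int m)"
    by (simp add: P_def i power_int_diff power_int_minus to_fract_power field_simps del: mult_pCons_left)
  ultimately show ?thesis
    by (simp only: vanishing_def laurentI mem_Collect_eq)
qed

lemma prod_lessThan_add:
  fixes a b :: nat
  shows "(\<Prod>j<a + b. f j) = (\<Prod>j<a. f j) * (\<Prod>j<b. f (a + j) :: 'a :: comm_monoid_mult)"
  by (induction b) (auto simp: mult_ac)

text \<open>Every block of \<open>d\<close> consecutive factors contains one that vanishes at \<open>\<omega>\<close>.\<close>

lemma vanishing_prod_progression:
  assumes \<omega>: "\<omega> \<in> primitive_roots d" "d > 0"
  shows "(\<Prod>j<n. 1 - to_fract [:\<omega> ^ u:] * qvar powi h * qvar ^ j) \<in> vanishing \<omega> (n div d)"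
proof -
  define f where "f j = 1 - to_fract [:\<omega> ^ u:] * qvar powi (h + int j)" for j
  have f: "1 - to_fract [:\<omega> ^ u:] * qvar powi h * qvar ^ j = f j" for j
    by (simp add: f_def power_int_add mult.assoc)
  have f0: "f j \<in> vanishing \<omega> 0" for j
    unfolding f_def by (rule vanishing_one_minus)
  have f1: "f j \<in> vanishing \<omega> 1" if "int d dvd int u + h + int j" for j
    unfolding f_def
  proof (rule vanishing_one_minus_root)
    show nz: "\<omega> \<noteq> 0" using \<omega> by (rule primitive_root_nonzero)
    have "\<omega> ^ u * \<omega> powi (h + int j) = \<omega> powi (int u + h + int j)"
      using nz by (simp add: power_int_add mult.assoc)
    then show "\<omega> ^ u * \<omega> powi (h + int j) = 1"
      using primitive_root_powi_eq_1[OF \<omega> that] by simp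
  qed
  have block: "(\<Prod>j<d. f (a + j)) \<in> vanishing \<omega> 1" for a
  proof -
    \<comment> \<open>The position in the block starting at \<open>a\<close> where the total
      exponent \<open>u + h + a + j0\<close> of \<omega> is divisible by \<open>d\<close>.\<close>
    define j0 where "j0 = nat ((- (int u + h + int a)) mod int d)"
    have j0: "j0 < d" using \<omega>(2) by (simp add: j0_def nat_less_iff)
    have "int j0 = (- (int u + h + int a)) mod int d"
      using \<omega>(2) by (simp add: j0_def)
    then have "int d dvd int u + h + int (a + j0)"
      by (simp add: dvd_eq_mod_eq_0 mod_add_right_eq add.assoc[symmetric])
    then have "f (a + j0) * (\<Prod>j\<in>{..<d} - {j0}. f (a + j)) \<in> vanishing \<omega> 1"
      by (intro vanishing_mult_right f1 vanishing_prod f0)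
    then show ?thesis using j0 by (subst prod.remove[of _ j0]) auto
  qed
  have "(\<Prod>j<N * d. f j) \<in> vanishing \<omega> N" for N
  proof (induction N)
    case (Suc N)
    have "(\<Prod>j<Suc N * d. f j) = (\<Prod>j<N * d. f j) * (\<Prod>j<d. f (N * d + j))"
      unfolding prod_lessThan_add[symmetric] by (simp add: add.commute)
    then show ?case
      using vanishing_mult[OF Suc block[of "N * d"]] by simp
  qed (simp add: vanishing_1)
  \<comment> \<open>The last \<open>n mod d\<close> factors form an incomplete block; they only need
    to be Laurent polynomials.\<close>
  then have "(\<Prod>j<n div d * d. f j) * (\<Prod>j<n mod d. f (n div d * d + j)) \<in> vanishing \<omega> (n div d)"
    by (intro vanishing_mult_right vanishing_prod f0)
  then show ?thesis
    unfolding f prod_lessThan_add[symmetric] by simp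
qed

text \<open>The coefficient of \<open>z ^ k\<close> in the product of
  \<open>1 - z * qvar ^ j\<close> over \<open>j < n\<close>.\<close>

definition qcoeff :: "nat \<Rightarrow> nat \<Rightarrow> complex poly fract" where
  "qcoeff n k = (-1) ^ k * qvar ^ (k choose 2) * q_binomial qvar (int n) (int k)"

text \<open>\<open>\<omega> ^ (d div c)\<close> is a primitive \<open>c\<close>-th root of unity, so
  this is a full geometric sum, which vanishes unless its ratio is 1.\<close>

lemma sum_roots_of_unity_filter:
  assumes \<omega>: "\<omega> \<in> primitive_roots d" "d > 0" and c: "c dvd d"
  shows "(\<Sum>t<c. \<omega> ^ (d div c * t * j)) = (if c dvd j then of_nat c else 0)"
proof -
  obtain m where m: "d = c * m" using c by auto
  with \<omega> have pos: "c > 0" "m > 0" by auto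
  have m': "d div c = m" using m pos by simp
  have "\<omega> ^ (m * j) = 1 \<longleftrightarrow> c dvd j"
    unfolding primitive_root_power_eq_1_iff[OF \<omega>] using pos by (simp add: m mult.commute)
  moreover have "(\<omega> ^ (m * j)) ^ c = 1"
  proof -
    have "(\<omega> ^ (m * j)) ^ c = (\<omega> ^ d) ^ j"
      by (simp add: m mult_ac flip: power_mult)
    then show ?thesis using \<omega>(1) by (simp add: primitive_roots_def)
  qed
  moreover have "(\<Sum>t<c. \<omega> ^ (d div c * t * j)) = (\<Sum>t<c. (\<omega> ^ (m * j)) ^ t)"
    by (simp add: m' mult_ac flip: power_mult)
  ultimately show ?thesis
    by (cases "c dvd j") (simp_all add: geometric_sum)
qed

lemma to_fract_const_mult: "to_fract [:x * y:] = to_fract [:x :: complex:] * to_fract [:y:]"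
  by (simp flip: to_fract_mult)

lemma to_fract_const_power: "to_fract [:x ^ n:] = to_fract [:x :: complex:] ^ n"
  by (induction n) (auto simp: to_fract_const_mult one_pCons simp flip: to_fract_1)

lemma to_fract_const_add: "to_fract [:x + y:] = to_fract [:x :: complex:] + to_fract [:y:]"
  by (simp flip: to_fract_add)

lemma to_fract_const_sum: "to_fract [:sum f A:] = (\<Sum>x\<in>A. to_fract [:f x :: complex:])"
  by (induction A rule: infinite_finite_induct) (auto simp: to_fract_const_add)

lemma vanishing_progression_sum:
  assumes \<omega>: "\<omega> \<in> primitive_roots d" "d > 0" and c: "c dvd d"
  shows "(\<Sum>k\<le>n. if c dvd k + s then qcoeff n k * (qvar powi h) ^ k else 0) \<in> vanishing \<omega> (n div d)"
    (is "?T \<in> _")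
proof -
  define \<kappa> where "\<kappa> x = to_fract [:x :: complex:]" for x
  define m where "m = d div c"
  have "c > 0" using \<omega> c by (auto intro: dvd_pos_nat)
  have filter: "(\<Sum>t<c. \<kappa> (\<omega> ^ (m * t * (k + s)))) = (if c dvd k + s then \<kappa> (of_nat c) else 0)" for k
    using sum_roots_of_unity_filter[OF assms, of "k + s"]
    by (simp add: \<kappa>_def m_def flip: to_fract_const_sum)
  \<comment> \<open>The filter yields the constant \<open>c\<close> instead of 1, so the sum is
    first scaled by \<open>c\<close>; the constant \<open>1 / of_nat c\<close> undoes this at the
    end.\<close>
  have "\<kappa> (of_nat c) * ?T
      = (\<Sum>k\<le>n. qcoeff n k * (qvar powi h) ^ k * (\<Sum>t<c. \<kappa> (\<omega> ^ (m * t * (k + s)))))"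
    unfolding filter sum_distrib_left by (intro sum.cong) auto
  also have "\<dots> = (\<Sum>k\<le>n. \<Sum>t<c. \<kappa> (\<omega> ^ (m * t * s)) * (qcoeff n k * (\<kappa> (\<omega> ^ (m * t)) * qvar powi h) ^ k))"
    unfolding sum_distrib_left
    by (intro sum.cong)
       (auto simp: \<kappa>_def power_mult_distrib distrib_left power_add to_fract_const_mult mult_ac
             simp flip: to_fract_const_power power_mult)
  also have "\<dots> = (\<Sum>t<c. \<kappa> (\<omega> ^ (m * t * s)) * (\<Sum>k\<le>n. qcoeff n k * (\<kappa> (\<omega> ^ (m * t)) * qvar powi h) ^ k))"
    unfolding sum_distrib_left by (rule sum.swap)
  \<comment> \<open>The q-binomial theorem at z =
    \<open>\<kappa> (\<omega> ^ (m * t)) * qvar powi h\<close>.\<close>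
  also have "\<dots> = (\<Sum>t<c. \<kappa> (\<omega> ^ (m * t * s)) * (\<Prod>j<n. 1 - \<kappa> (\<omega> ^ (m * t)) * qvar powi h * qvar ^ j))"
    using q_binomial_theorem[of qvar _ n] qvar_power_neq_1 by (simp add: qcoeff_def)
  also have "\<dots> \<in> vanishing \<omega> (n div d)"
    unfolding \<kappa>_def
    by (intro vanishing_sum vanishing_mult_left vanishing_to_fract vanishing_prod_progression \<omega>)
  finally have "\<kappa> (1 / of_nat c) * (\<kappa> (of_nat c) * ?T) \<in> vanishing \<omega> (n div d)"
    unfolding \<kappa>_def by (rule vanishing_mult_left[OF vanishing_to_fract])
  moreover have inv: "\<kappa> (1 / of_nat c) * \<kappa> (of_nat c) = 1"
    using \<open>c > 0\<close> by (simp add: \<kappa>_def one_pCons flip: to_fract_const_mult to_fract_1)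
  ultimately show ?thesis
    by (simp only: mult.assoc[symmetric] inv mult_1)
qed

text \<open>Expanding the last factor gives two sums with one factor fewer, at \<open>h\<close> and
  at \<open>h + 1\<close>; hence the induction on \<open>l\<close> for all \<open>h\<close>.\<close>

lemma vanishing_weighted_progression_sum:
  fixes l :: nat
  assumes "\<omega> \<in> primitive_roots d" "d > 0" "c dvd d"
  shows "(\<Sum>k\<le>n. if c dvd k + s then qcoeff n k * (qvar powi h) ^ k
      * (\<Prod>i<l. 1 - qvar powi g i * qvar ^ k) else 0) \<in> vanishing \<omega> (n div d)"
proof (induction l arbitrary: h)
  case 0
  then show ?case using vanishing_progression_sum[OF assms] by (simp cong: if_cong)
next
  case (Suc l)
  define T where "T h k = (if c dvd k + s then qcoeff n k * (qvar powi h) ^ k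
      * (\<Prod>i<l. 1 - qvar powi g i * qvar ^ k) else 0)" for h k
  have "(\<Sum>k\<le>n. if c dvd k + s then qcoeff n k * (qvar powi h) ^ k
      * (\<Prod>i<Suc l. 1 - qvar powi g i * qvar ^ k) else 0)
      = (\<Sum>k\<le>n. T h k - qvar powi g l * T (h + 1) k)"
    by (intro sum.cong) (auto simp: T_def power_int_add power_mult_distrib algebra_simps)
  also have "\<dots> = (\<Sum>k\<le>n. T h k) - qvar powi g l * (\<Sum>k\<le>n. T (h + 1) k)"
    by (simp add: sum_subtractf sum_distrib_left)
  also have "\<dots> \<in> vanishing \<omega> (n div d)"
    using Suc unfolding T_def by (intro vanishing_diff vanishing_mult_left vanishing_powi) auto
  finally show ?case .
qed

subsection \<open>Divisibility of the sum\<close>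

text \<open>Replaces \<open>- r\<close> by its least nonnegative residue, so that the filter works
  with natural exponents.\<close>

lemma dvd_add_nat_mod_iff:
  assumes "c > 0"
  shows "c dvd k + nat (- r mod int c) \<longleftrightarrow> int c dvd int k - r"
proof -
  have "c dvd k + nat (- r mod int c) \<longleftrightarrow> int c dvd int k + (- r mod int c)"
    using assms by (subst int_dvd_int_iff[symmetric]) simp
  also have "\<dots> \<longleftrightarrow> int c dvd int k - r"
    by (simp add: dvd_eq_mod_eq_0 mod_add_right_eq)
  finally show ?thesis .
qed

text \<open>Outside \<open>{0..int n}\<close> the first Gaussian binomial vanishes, so natural
  indices suffice and the sum takes the shape required by the filter.\<close>

lemma S_sum_eq:
  assumes "c > 0"
  shows "S_sum n c r h l = (\<Sum>k\<le>n. if c dvd k + nat (- r mod int c)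
    then qcoeff n k * (qvar powi h) ^ k * q_binomial (qvar ^ c) ((int k - r) div int c) (int l) else 0)"
proof -
  have cong: "[int k = r] (mod int c) \<longleftrightarrow> c dvd k + nat (- r mod int c)" for k
    using dvd_add_nat_mod_iff[OF assms] by (simp add: cong_iff_dvd_diff)
  have term_eq: "S_term n c r h l (int k)
      = qcoeff n k * (qvar powi h) ^ k * q_binomial (qvar ^ c) ((int k - r) div int c) (int l)" for k
  proof -
    have "int k * (int k - 1) div 2 = int (k choose 2)"
      by (cases k) (simp_all add: choose_two zdiv_int algebra_simps)
    then have "qvar powi (int k * (int k - 1) div 2 + h * int k) = qvar ^ (k choose 2) * (qvar powi h) ^ k"
      by (simp add: power_int_add power_int_power')
    then show ?thesis by (simp add: S_term_def qcoeff_def mult_ac)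
  qed
  have "S_sum n c r h l = (\<Sum>k\<in>{0..int n}. if [k = r] (mod int c) then S_term n c r h l k else 0)"
    unfolding S_sum_def
  proof (rule Sum_any.expand_superset)
    show "{k. (if [k = r] (mod int c) then S_term n c r h l k else 0) \<noteq> 0} \<subseteq> {0..int n}"
    proof
      fix k assume "k \<in> {k. (if [k = r] (mod int c) then S_term n c r h l k else 0) \<noteq> 0}"
      then have nz: "q_binomial qvar (int n) k \<noteq> 0"
        by (auto simp: S_term_def split: if_splits)
      then have "k \<ge> 0" by (auto simp: q_binomial_def split: if_splits)
      then show "k \<in> {0..int n}"
        using nz q_binomial_eq_0[of n "nat k" qvar] by (cases "n < nat k") auto
    qed
  qed simp
  also have "{0..int n} = int ` {..n}"
    by (auto simp: image_int_atLeastAtMost atMost_atLeast0)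
  finally show ?thesis
    by (simp add: sum.reindex cong term_eq cong: if_cong)
qed

text \<open>As the division by \<open>c\<close> is exact, \<open>c\<close> times the upper entry is
  \<open>k - r\<close>. Each factor thus depends on \<open>k\<close> only through
  \<open>qvar ^ k\<close>, as in \<open>vanishing_weighted_progression_sum\<close>.\<close>

lemma q_binomial_mult_qfact_qvar:
  assumes "c > 0" and "int c dvd int k - r"
  shows "q_binomial (qvar ^ c) ((int k - r) div int c) (int l) * qfact (qvar ^ c) l
    = (\<Prod>i<l. 1 - qvar powi (- r - int c * int i) * qvar ^ k)"
proof -
  have "(qvar ^ c) powi ((int k - r) div int c - int i) = qvar powi (- r - int c * int i) * qvar ^ k" for i
  proof -
    have "int c * ((int k - r) div int c - int i) = (- r - int c * int i) + int k"
      using assms by (simp add: right_diff_distrib)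
    then show ?thesis by (simp add: power_int_power power_int_add del: of_nat_mult)
  qed
  then show ?thesis
    using qfact_nonzero[of "qvar ^ c" l] q_binomial_altdef[of "qvar ^ c" _ l] qvar_power_power_neq_1[OF assms(1)]
    by (simp add: qfalling_def)
qed

lemma vanishing_S_sum_multiple:
  assumes \<omega>: "\<omega> \<in> primitive_roots d" "d > 0" and c: "c dvd d" "c > 0"
  shows "S_sum n c r h l \<in> vanishing \<omega> (n div d - l * c div d)"
proof (rule vanishing_cancel_qfact)
  show "S_sum n c r h l \<in> vanishing \<omega> 0"
    using int_laurent_S_sum[OF c(2)] int_laurent_vanishing by blast
  define s where "s = nat (- r mod int c)"
  have dvd: "int c dvd int k - r" if "c dvd k + s" for k
    using that dvd_add_nat_mod_iff[OF c(2)] by (simp add: s_def)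
  have "S_sum n c r h l * qfact (qvar ^ c) l = (\<Sum>k\<le>n. if c dvd k + s then qcoeff n k * (qvar powi h) ^ k
      * (\<Prod>i<l. 1 - qvar powi (- r - int c * int i) * qvar ^ k) else 0)"
    unfolding S_sum_eq[OF c(2)] s_def[symmetric] sum_distrib_right
    by (intro sum.cong) (auto simp: mult.assoc q_binomial_mult_qfact_qvar[OF c(2) dvd])
  then show "S_sum n c r h l * qfact (qvar ^ c) l \<in> vanishing \<omega> (n div d)"
    using vanishing_weighted_progression_sum[OF \<omega> c(1)] by simp
qed (use assms in auto)

text \<open>The q-factorials of \<open>k\<close> and \<open>n - k\<close> are cancelled one after
  the other from that of \<open>n\<close>, all orders coming from \<open>order_qfact\<close> with
  \<open>c = 1\<close>.\<close>

lemma vanishing_q_binomial: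
  assumes \<omega>: "\<omega> \<in> primitive_roots b" "b > 0" and "k \<le> n"
  shows "q_binomial qvar (int n) (int k) \<in> vanishing \<omega> (n div b - (n - k) div b - k div b)"
proof -
  define f where "f = q_binomial qvar (int n) (int k)"
  have f0: "f \<in> vanishing \<omega> 0"
    using int_laurent_q_binomial[of 1 "int n" "int k"] int_laurent_vanishing by (auto simp: f_def)
  have qf: "qfact (qvar ^ 1) m \<in> vanishing \<omega> (m div b)" for m
    unfolding to_fract_qfact_X[symmetric] vanishing_def
    using order_qfact[OF \<omega>, of 1 m] order_1[of \<omega> "qfact ([:0, 1:] ^ 1) m"]
    by (intro laurent_to_fract) simp
  have "f * qfact (qvar ^ 1) k * qfact (qvar ^ 1) (n - k) = qfact (qvar ^ 1) n"
    using q_binomial_mult_qfact[of qvar k n] assms(3) qvar_power_neq_1 by (simp add: f_def)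
  then have vanish: "f * qfact (qvar ^ 1) k * qfact (qvar ^ 1) (n - k) \<in> vanishing \<omega> (n div b)"
    using qf by simp
  have "f * qfact (qvar ^ 1) k \<in> vanishing \<omega> (n div b - (n - k) * 1 div b)"
  proof (rule vanishing_cancel_qfact)
    show "f * qfact (qvar ^ 1) k \<in> vanishing \<omega> 0"
      using qf[of k] vanishing_antimono[of 0 "k div b" \<omega>] by (intro vanishing_mult_left f0) auto
  qed (use \<omega> vanish in auto)
  then have "f \<in> vanishing \<omega> (n div b - (n - k) * 1 div b - k * 1 div b)"
    using \<omega> by (intro vanishing_cancel_qfact[OF f0]) auto
  then show ?thesis by (simp add: f_def)
qed

lemma vanishing_S_sum_divisor:
  assumes \<omega>: "\<omega> \<in> primitive_roots b" "b > 0" and c: "b dvd c" "c > 0"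
  shows "S_sum n c r h l \<in> vanishing \<omega> (nat (int n div int b - r div int b - (int n - r) div int b))"
  unfolding S_sum_eq[OF c(2)]
proof (intro vanishing_sum)
  fix k assume "k \<in> {..n}"
  then have "k \<le> n" by simp
  let ?e = "nat (int n div int b - r div int b - (int n - r) div int b)"
  have "qcoeff n k * (qvar powi h) ^ k * q_binomial (qvar ^ c) ((int k - r) div int c) (int l)
      \<in> vanishing \<omega> ?e" if "c dvd k + nat (- r mod int c)"
  proof -
    have "int c dvd int k - r"
      using that dvd_add_nat_mod_iff[OF c(2)] by simp
    then have "int b dvd int k - r"
      using c(1) by (meson dvd_trans int_dvd_int_iff)
    then obtain t where "int k - r = int b * t" by (rule dvdE)
    then have t: "int k = r + int b * t" "int (n - k) = int n - r + int b * (- t)"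
      using \<open>k \<le> n\<close> by (simp_all add: algebra_simps of_nat_diff)
    \<comment> \<open>Passing from \<open>r\<close> to \<open>k\<close> raises one floor by
      \<open>t\<close> and lowers the other by \<open>t\<close>, so their sum is unchanged.\<close>
    have "int k div int b = r div int b + t" "int (n - k) div int b = (int n - r) div int b - t"
      unfolding t using \<omega>(2) by (subst div_mult_self2; simp)+
    then have "int (n div b) - int ((n - k) div b) - int (k div b)
        = int n div int b - r div int b - (int n - r) div int b"
      by (simp add: zdiv_int)
    then have e: "?e \<le> n div b - (n - k) div b - k div b" by linarith
    have binomial: "q_binomial qvar (int n) (int k) \<in> vanishing \<omega> ?e"
      using vanishing_q_binomial[OF \<omega> \<open>k \<le> n\<close>] vanishing_antimono[OF e] by blast
    have sign: "(-1) ^ k * qvar ^ (k choose 2) \<in> vanishing \<omega> 0"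
    proof -
      have "(-1) ^ k * qvar ^ (k choose 2) = to_fract ((-1) ^ k * [:0, 1:] ^ (k choose 2))"
        by (simp add: to_fract_power del: mult_pCons_left mult_pCons_right)
      then show ?thesis using vanishing_to_fract by metis
    qed
    have power: "(qvar powi h) ^ k \<in> vanishing \<omega> 0"
      using vanishing_powi by (simp only: power_int_power')
    have "q_binomial (qvar ^ c) ((int k - r) div int c) (int l) \<in> vanishing \<omega> 0"
      using int_laurent_q_binomial[OF c(2)] int_laurent_vanishing by blast
    then show ?thesis
      unfolding qcoeff_def
      by (rule vanishing_mult_right[OF vanishing_mult_right[OF vanishing_mult_left[OF sign binomial] power]])
  qed
  then show "(if c dvd k + nat (- r mod int c) then qcoeff n k * (qvar powi h) ^ k
      * q_binomial (qvar ^ c) ((int k - r) div int c) (int l) else 0) \<in> vanishing \<omega> ?e"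
    by (simp add: vanishing_0)
qed

text \<open>Both products of \<open>P_prod\<close> in a single exponent function;
  \<open>d = c\<close> falls under the first case, matching \<open>b < c\<close> in the second
  product.\<close>

definition P_exponent :: "nat \<Rightarrow> nat \<Rightarrow> int \<Rightarrow> nat \<Rightarrow> nat \<Rightarrow> int" where
  "P_exponent n c r l d =
    (if c dvd d then int n div int d - int (l * c) div int d
     else if d dvd c then int n div int d - r div int d - (int n - r) div int d else 0)"

lemma P_prod_eq:
  assumes "c > 0"
  shows "P_prod n c r l
    = (\<Prod>d\<in>{1..n + l * c + c}. to_fract (cyclotomic_poly d) powi P_exponent n c r l d)"
proof -
  \<comment> \<open>Large enough for all divisors of \<open>c\<close> and for every \<open>d\<close>
    up to \<open>max n (l * c)\<close>, beyond which the exponents in the first product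
    vanish.\<close>
  define D where "D = {1..n + l * c + c}"
  let ?\<Phi> = "\<lambda>d. to_fract (cyclotomic_poly d) powi P_exponent n c r l d"
  have "Prod_any (\<lambda>d. if d \<ge> 1 \<and> c dvd d
      then to_fract (cyclotomic_poly d) powi (int n div int d - int (l * c) div int d) else 1)
    = (\<Prod>d\<in>D. if d \<ge> 1 \<and> c dvd d
      then to_fract (cyclotomic_poly d) powi (int n div int d - int (l * c) div int d) else 1)"
  proof (rule Prod_any.expand_superset)
    show "{d. (if d \<ge> 1 \<and> c dvd d
       then to_fract (cyclotomic_poly d) powi (int n div int d - int (l * c) div int d) else 1) \<noteq> 1} \<subseteq> D"
    proof
      fix d
      assume d: "d \<in> {d. (if d \<ge> 1 \<and> c dvd d
       then to_fract (cyclotomic_poly d) powi (int n div int d - int (l * c) div int d) else 1) \<noteq> 1}"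
      show "d \<in> D"
      proof (rule ccontr)
        assume "d \<notin> D"
        with d have "d > n + l * c" by (auto simp: D_def split: if_splits)
        then have "int n div int d = 0" "int (l * c) div int d = 0"
          by (auto simp flip: zdiv_int simp del: of_nat_mult)
        then show False using d by (auto simp del: of_nat_mult split: if_splits)
      qed
    qed
  qed (simp add: D_def)
  also have "\<dots> = (\<Prod>d\<in>{d\<in>D. c dvd d}. ?\<Phi> d)"
    by (subst prod.inter_filter) (auto simp: D_def P_exponent_def intro!: prod.cong)
  finally have 1: "Prod_any (\<lambda>d. if d \<ge> 1 \<and> c dvd d
      then to_fract (cyclotomic_poly d) powi (int n div int d - int (l * c) div int d) else 1)
    = (\<Prod>d\<in>{d\<in>D. c dvd d}. ?\<Phi> d)" .
  have "(\<Prod>b\<in>{b. b dvd c \<and> b < c}.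
          to_fract (cyclotomic_poly b) powi (int n div int b - r div int b - (int n - r) div int b))
     = (\<Prod>b\<in>{b. b dvd c \<and> b < c}. ?\<Phi> b)"
    using assms by (intro prod.cong) (auto simp: P_exponent_def dest: dvd_imp_le intro: dvd_pos_nat)
  also have "\<dots> = (\<Prod>d\<in>{d\<in>D. \<not> c dvd d}. ?\<Phi> d)"
  proof (rule prod.mono_neutral_left)
    show "{b. b dvd c \<and> b < c} \<subseteq> {d \<in> D. \<not> c dvd d}"
      using assms by (auto simp: D_def Suc_le_eq dest: dvd_imp_le intro: dvd_pos_nat)
    show "\<forall>i\<in>{d \<in> D. \<not> c dvd d} - {b. b dvd c \<and> b < c}. ?\<Phi> i = 1"
      using assms by (auto simp: P_exponent_def dest: dvd_imp_le)
  qed (simp add: D_def)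
  finally have 2: "(\<Prod>b\<in>{b. b dvd c \<and> b < c}.
          to_fract (cyclotomic_poly b) powi (int n div int b - r div int b - (int n - r) div int b))
     = (\<Prod>d\<in>{d\<in>D. \<not> c dvd d}. ?\<Phi> d)" .
  have "(\<Prod>d\<in>D. ?\<Phi> d) = (\<Prod>d\<in>{d\<in>D. c dvd d}. ?\<Phi> d) * (\<Prod>d\<in>{d\<in>D. \<not> c dvd d}. ?\<Phi> d)"
    by (subst prod.union_disjoint[symmetric]) (auto simp: D_def intro!: prod.cong)
  then show ?thesis unfolding P_prod_def 1 2 D_def by simp
qed

text \<open>Negative exponents count as 0 here, where being a Laurent polynomial is enough; the
  corresponding factors stand in the denominator of \<open>P_prod\<close>.\<close>

lemma vanishing_S_sum:
  assumes "\<omega> \<in> primitive_roots d" "d > 0" "c > 0"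
  shows "S_sum n c r h l \<in> vanishing \<omega> (nat (P_exponent n c r l d))"
proof -
  have "nat (int n div int d - int (l * c) div int d) = n div d - l * c div d"
    by (simp add: nat_diff_distrib' flip: zdiv_int del: of_nat_mult)
  moreover have "S_sum n c r h l \<in> vanishing \<omega> 0"
    using int_laurent_S_sum[OF assms(3)] int_laurent_vanishing by blast
  ultimately show ?thesis
    using vanishing_S_sum_multiple[OF assms(1,2) _ assms(3)] vanishing_S_sum_divisor[OF assms(1,2) _ assms(3)]
    by (auto simp: P_exponent_def simp del: of_nat_mult)
qed

text \<open>A root is primitive for at most one \<open>d\<close> in \<open>D\<close>, so
  \<open>m\<close> becomes a multiplicity \<mu> on roots and everything merges into one product of
  powers of distinct linear factors.\<close>

lemma prod_cyclotomic_powers_dvd: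
  assumes "finite D" "0 \<notin> D"
    and "\<And>d \<omega>. d \<in> D \<Longrightarrow> \<omega> \<in> primitive_roots d \<Longrightarrow> [:- \<omega>, 1:] ^ m d dvd p"
  shows "(\<Prod>d\<in>D. cyclotomic_poly d ^ m d) dvd p"
proof -
  have pos: "d > 0" if "d \<in> D" for d using that assms(2) by (cases d) auto
  define \<mu> where "\<mu> \<omega> = m (THE d. d \<in> D \<and> \<omega> \<in> primitive_roots d)" for \<omega>
  have \<mu>: "\<mu> \<omega> = m d" if "d \<in> D" "\<omega> \<in> primitive_roots d" for d \<omega>
  proof -
    have "(THE d. d \<in> D \<and> \<omega> \<in> primitive_roots d) = d"
      using that primitive_roots_disjoint pos by (intro the_equality) blast+
    then show ?thesis by (simp add: \<mu>_def)
  qed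
  have "(\<Prod>d\<in>D. cyclotomic_poly d ^ m d) = (\<Prod>d\<in>D. \<Prod>\<omega>\<in>primitive_roots d. [:- \<omega>, 1:] ^ \<mu> \<omega>)"
    unfolding cyclotomic_poly_altdef prod_power_distrib
    by (intro prod.cong refl) (simp add: \<mu>)
  also have "\<dots> = (\<Prod>\<omega>\<in>(\<Union>d\<in>D. primitive_roots d). [:- \<omega>, 1:] ^ \<mu> \<omega>)"
    using assms(1) pos
    by (intro prod.UNION_disjoint[symmetric] ballI impI finite_primitive_roots primitive_roots_disjoint) auto
  also have "\<dots> dvd p"
    using assms pos by (intro prod_linear_powers_dvd) (auto simp: \<mu> intro: finite_primitive_roots)
  finally show ?thesis .
qed

lemma powi_eq_divide: "x \<noteq> 0 \<Longrightarrow> x powi e = x ^ nat e / x ^ nat (- e)" for x :: "'a::field"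
  by (cases "e \<ge> 0") (auto simp: power_int_def divide_inverse power_inverse)

theorem theorem1p1:
  fixes n c l :: nat and r h :: int
  assumes "n > 0" and "c > 0"
  shows "S_sum n c r h l / P_prod n c r l \<in> int_laurent_polys"
proof -
  define D where "D = {1..n + l * c + c}"
  define e where "e = P_exponent n c r l"
  obtain C :: "nat \<Rightarrow> int poly" where C: "\<And>d. d > 0 \<Longrightarrow> lead_coeff (C d) = 1"
      "\<And>d. d > 0 \<Longrightarrow> cyclotomic_poly d = map_poly of_int (C d)"
    using cyclotomic_poly_int by metis
  \<comment> \<open>\<open>N\<close> and \<open>M\<close> collect the positive and negative
    exponents, so that \<open>P_prod\<close> is the quotient of two monic integer
    polynomials.\<close>
  define N where "N = (\<Prod>d\<in>D. C d ^ nat (e d))"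
  define M where "M = (\<Prod>d\<in>D. C d ^ nat (- e d))"
  have N: "map_poly of_int N = (\<Prod>d\<in>D. cyclotomic_poly d ^ nat (e d))"
    and M: "map_poly of_int M = (\<Prod>d\<in>D. cyclotomic_poly d ^ nat (- e d))"
    using C(2) by (auto simp: N_def M_def D_def map_poly_of_int_prod map_poly_of_int_power intro!: prod.cong)
  have monic: "lead_coeff N = 1"
    using C(1) by (auto simp: N_def D_def lead_coeff_prod lead_coeff_power intro!: prod.neutral)
  have nz: "to_fract (cyclotomic_poly d) \<noteq> 0" if "d \<in> D" for d
    using C(1)[of d] C(2)[of d] that by (auto simp: D_def)
  have P: "P_prod n c r l = to_fract (map_poly of_int N) / to_fract (map_poly of_int M)"
    unfolding P_prod_eq[OF assms(2)] D_def[symmetric] e_def[symmetric] N M to_fract_prod to_fract_power prod_dividef[symmetric]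
    by (intro prod.cong refl powi_eq_divide nz)
  obtain A j where S: "S_sum n c r h l = to_fract (map_poly of_int A) * qvar powi j"
    using int_laurent_S_sum[OF assms(2), of n r h l] by (auto simp: int_laurent_polys_def)
  \<comment> \<open>Divisibility over the complex numbers, checked root by root.\<close>
  have "map_poly of_int N dvd (map_poly of_int A :: complex poly)"
    unfolding N
  proof (rule prod_cyclotomic_powers_dvd)
    fix d \<omega> assume d: "d \<in> D" and \<omega>: "\<omega> \<in> primitive_roots d"
    have "d > 0" using d by (auto simp: D_def)
    then show "[:- \<omega>, 1:] ^ nat (e d) dvd map_poly of_int A"
      using vanishing_S_sum[OF \<omega> \<open>d > 0\<close> assms(2), of n r h l] primitive_root_nonzero[OF \<omega>]
      unfolding S e_def by (intro vanishing_dvd) auto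
  qed (auto simp: D_def)
  then obtain B where B: "map_poly of_int A = map_poly of_int N * (B :: complex poly)" by (rule dvdE)
  \<comment> \<open>Since \<open>N\<close> is monic, the complex quotient has integer coefficients;
    \<open>M\<close> then only contributes a further integral factor.\<close>
  with monic_int_poly_quotient[OF monic] obtain B' where B': "B = map_poly of_int B'" by blast
  have "N \<noteq> 0" using monic by auto
  then have "S_sum n c r h l / P_prod n c r l = to_fract (map_poly of_int (B' * M)) * qvar powi j"
    unfolding S P B B' by (simp add: map_poly_of_int_mult)
  then show ?thesis by (auto simp: int_laurent_polys_def)
qed

end
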